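(* Let $X$ be a Tychonoff space. If $p$ and $q$ are distinct points of $\beta X\setminus\upsilon X$, then $C_p$ and $C_q$ are distinct intermediate rings.
   Context: $C(X)$ is the ring of real-valued continuous functions on $X$, $C^*(X)$ its subring of bounded functions, and $\beta X$ the Stone-Čech compactification of $X$. An intermediate ring is a subring of $C(X)$ containing $C^*(X)$. For $f\in C(X)$, $f^*:\beta X\to\mathbb{R}\cup\{\infty\}$ (one-point compactification of $\mathbb{R}$) is the unique continuous extension of $f$. For $p\in\beta X$, $C_p=\{f\in C(X): f^*(p)\in\mathbb{R}\}$. The Hewitt realcompactification is $\upsilon X=\{p\in\beta X: f^*(p)\in\mathbb{R}\text{ for each }f\in C(X)\}$. *)

theory Defs
  imports "HOL-Analysis.Analysis" "HOL-Algebra.Subrings"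
begin

definition Tychonoff_space :: "'a topology \<Rightarrow> bool" where
  "Tychonoff_space X \<longleftrightarrow> completely_regular_space X \<and> Hausdorff_space X"


section \<open>The rings of continuous and of bounded continuous functions\<close>

text \<open>A function on a space is represented by its extensional extension, so that equality
  of elements of the ring is equality on \<^term>\<open>topspace X\<close>.\<close>

definition C_ring :: "'a topology \<Rightarrow> ('a \<Rightarrow> real) ring" where
  "C_ring X =
    \<lparr>carrier = {f \<in> extensional (topspace X). continuous_map X euclideanreal f},
     mult = (\<lambda>f g. \<lambda>x\<in>topspace X. f x * g x),
     one = (\<lambda>x\<in>topspace X. 1),
     zero = (\<lambda>x\<in>topspace X. 0),
     add = (\<lambda>f g. \<lambda>x\<in>topspace X. f x + g x)\<rparr>"

definition C_star :: "'a topology \<Rightarrow> ('a \<Rightarrow> real) set" where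
  "C_star X = {f \<in> carrier (C_ring X). bounded (f ` topspace X)}"

definition intermediate_ring :: "'a topology \<Rightarrow> ('a \<Rightarrow> real) set \<Rightarrow> bool" where
  "intermediate_ring X A \<longleftrightarrow> subring A (C_ring X) \<and> C_star X \<subseteq> A"


section \<open>The Stone-Cech compactification\<close>

text \<open>The classical construction: the closure of the image of \<open>X\<close> in a product of copies of
  the real line indexed by the bounded continuous functions, under the evaluation map.  Points
  of \<open>X\<close> are identified with their images under \<open>beta_embed X\<close>; the lemmas below show that for
  Tychonoff \<open>X\<close> this is a dense embedding into a compact Hausdorff space, through which
  every continuous map from \<open>X\<close> to a compact Hausdorff space factors uniquely.\<close>

definition beta_embed :: "'a topology \<Rightarrow> 'a \<Rightarrow> (('a \<Rightarrow> real) \<Rightarrow> real)" where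
  "beta_embed X x = (\<lambda>f\<in>C_star X. f x)"

definition beta :: "'a topology \<Rightarrow> (('a \<Rightarrow> real) \<Rightarrow> real) topology" where
  "beta X =
    (let P = product_topology (\<lambda>_. euclideanreal) (C_star X)
     in subtopology P (P closure_of (beta_embed X ` topspace X)))"

text \<open>The extension \<open>f\<^sup>*\<close>, with values in the one-point compactification of the reals; the added
  point is \<^term>\<open>None :: real option\<close>.  Well-definedness is \<open>ex1_star_extension\<close> below.\<close>

definition star_extension ::
  "'a topology \<Rightarrow> ('a \<Rightarrow> real) \<Rightarrow> (('a \<Rightarrow> real) \<Rightarrow> real) \<Rightarrow> real option" where
  "star_extension X f =
    (THE F. F \<in> extensional (topspace (beta X)) \<and>
            continuous_map (beta X) (Alexandroff_compactification euclideanreal) F \<and>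
            (\<forall>x\<in>topspace X. F (beta_embed X x) = Some (f x)))"

definition C_at :: "'a topology \<Rightarrow> (('a \<Rightarrow> real) \<Rightarrow> real) \<Rightarrow> ('a \<Rightarrow> real) set" where
  "C_at X p = {f \<in> carrier (C_ring X). star_extension X f p \<in> range Some}"

definition upsilon :: "'a topology \<Rightarrow> (('a \<Rightarrow> real) \<Rightarrow> real) set" where
  "upsilon X =
    {p \<in> topspace (beta X). \<forall>f\<in>carrier (C_ring X). star_extension X f p \<in> range Some}"


section \<open>The notions are well defined\<close>

lemma cring_C_ring: "cring (C_ring X)"
proof (intro cringI abelian_groupI comm_monoidI)
  fix f assume f: "f \<in> carrier (C_ring X)"
  show "\<exists>g\<in>carrier (C_ring X). g \<oplus>\<^bsub>C_ring X\<^esub> f = \<zero>\<^bsub>C_ring X\<^esub>"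
    by (rule bexI [where x = "\<lambda>x\<in>topspace X. - f x"])
      (use f in \<open>auto simp: C_ring_def fun_eq_iff intro: continuous_map_eq [where f = "\<lambda>x. - f x"]\<close>)
next
  fix f g assume fg: "f \<in> carrier (C_ring X)" "g \<in> carrier (C_ring X)"
  show "f \<oplus>\<^bsub>C_ring X\<^esub> g \<in> carrier (C_ring X)"
    using fg by (auto simp: C_ring_def
        intro: continuous_map_eq [where f = "\<lambda>x. f x + g x"] continuous_map_add)
  show "f \<otimes>\<^bsub>C_ring X\<^esub> g \<in> carrier (C_ring X)"
    using fg by (auto simp: C_ring_def
        intro: continuous_map_eq [where f = "\<lambda>x. f x * g x"] continuous_map_real_mult)
qed (auto simp: C_ring_def fun_eq_iff algebra_simps extensional_def
       intro: continuous_map_eq [where f = "\<lambda>x. 0"] continuous_map_eq [where f = "\<lambda>x. 1"])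

lemma C_star_iff:
  "f \<in> C_star X \<longleftrightarrow>
   f \<in> extensional (topspace X) \<and> continuous_map X euclideanreal f \<and> bounded (f ` topspace X)"
  by (auto simp: C_star_def C_ring_def)

lemma continuous_map_beta_embed_product:
  "continuous_map X (product_topology (\<lambda>_. euclideanreal) (C_star X)) (beta_embed X)"
  by (auto simp: continuous_map_componentwise beta_embed_def C_star_iff)

lemma beta_embed_in_product:
  "beta_embed X ` topspace X \<subseteq> topspace (product_topology (\<lambda>_. euclideanreal) (C_star X))"
  by (auto simp: beta_embed_def)

lemma topspace_beta:
  "topspace (beta X) =
   (product_topology (\<lambda>_. euclideanreal) (C_star X)) closure_of (beta_embed X ` topspace X)"
  unfolding beta_def Let_def by (rule topspace_subtopology_subset [OF closure_of_subset_topspace])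

lemma beta_embed_subset: "beta_embed X ` topspace X \<subseteq> topspace (beta X)"
  unfolding topspace_beta by (rule closure_of_subset [OF beta_embed_in_product])

lemma compact_space_beta: "compact_space (beta X)"
proof -
  let ?P = "product_topology (\<lambda>_. euclideanreal) (C_star X)"
  have "\<exists>b. \<forall>x\<in>topspace X. \<bar>f x\<bar> \<le> b" if "f \<in> C_star X" for f
    using that by (auto simp: C_star_iff bounded_iff)
  then obtain b where b: "\<And>f x. f \<in> C_star X \<Longrightarrow> x \<in> topspace X \<Longrightarrow> \<bar>f x\<bar> \<le> b f"
    by metis
  let ?K = "PiE (C_star X) (\<lambda>f. {- b f..b f})"
  have K: "compactin ?P ?K"
    by (auto simp: compactin_PiE)
  have "closedin ?P ?K"
    by (auto simp: closedin_product_topology)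
  moreover have "beta_embed X ` topspace X \<subseteq> ?K"
    using b by (fastforce simp: beta_embed_def abs_le_iff)
  ultimately have "?P closure_of (beta_embed X ` topspace X) \<subseteq> ?K"
    by (rule closure_of_minimal [rotated])
  then have "compactin ?P (?P closure_of (beta_embed X ` topspace X))"
    using K closed_compactin closedin_closure_of by blast
  then show ?thesis
    by (simp add: beta_def Let_def compact_space_subtopology)
qed

lemma Hausdorff_space_beta: "Hausdorff_space (beta X)"
  by (simp add: beta_def Let_def Hausdorff_space_subtopology Hausdorff_space_product_topology)

lemma dense_beta_embed: "beta X closure_of (beta_embed X ` topspace X) = topspace (beta X)"
proof -
  let ?P = "product_topology (\<lambda>_. euclideanreal) (C_star X)"
  let ?E = "beta_embed X ` topspace X"
  have "?P closure_of ?E \<inter> ?E = ?E"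
    using beta_embed_subset [of X] unfolding topspace_beta by blast
  then show ?thesis
    unfolding topspace_beta unfolding beta_def Let_def closure_of_subtopology by simp
qed

lemma embedding_map_beta_embed_product:
  assumes "Tychonoff_space X"
  shows "embedding_map X (product_topology (\<lambda>_. euclideanreal) (C_star X)) (beta_embed X)"
proof -
  let ?P = "product_topology (\<lambda>_. euclideanreal) (C_star X)"
  define K where
    "K = mspace (submetric (cfunspace X euclidean_metric) {f. f \<in> topspace X \<rightarrow> {0..1::real}})"
  define Q where "Q = product_topology (\<lambda>f::'a \<Rightarrow> real. top_of_set {0..1::real}) K"
  define e where "e = (\<lambda>x::'a. \<lambda>f\<in>K. f x)"
  have K: "K \<subseteq> C_star X"
    by (auto simp: K_def C_star_iff)
  have "embedding_map X Q e"
    using completely_regular_space_cube_embedding_explicit [of X] assms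
    unfolding Tychonoff_space_def K_def Q_def e_def by auto
  then obtain e' where e': "continuous_map (subtopology Q (e ` topspace X)) X e'"
    "\<And>x. x \<in> topspace X \<Longrightarrow> e' (e x) = x" and e: "continuous_map X Q e"
    by (auto simp: embedding_map_def homeomorphic_map_maps homeomorphic_maps_def
        continuous_map_in_subtopology)
  let ?r = "\<lambda>p::('a \<Rightarrow> real) \<Rightarrow> real. restrict p K"
  have r: "?r (beta_embed X x) = e x" for x
    using K by (auto simp: beta_embed_def e_def fun_eq_iff)
  have "continuous_map (subtopology ?P (beta_embed X ` topspace X))
      (subtopology Q (e ` topspace X)) ?r"
  proof -
    have "?r p \<in> topspace Q" if "p \<in> beta_embed X ` topspace X" for p
      using that r e by (force simp: continuous_map_def)
    then have *: "p k \<in> {0..1}" if "p \<in> beta_embed X ` topspace X" "k \<in> K" for p k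
      using that by (fastforce simp: Q_def PiE_iff)
    have "continuous_map (subtopology ?P (beta_embed X ` topspace X)) (top_of_set {0..1})
        (\<lambda>p. p k)" if "k \<in> K" for k
      unfolding continuous_map_in_subtopology
      using * that K
      by (auto intro!: continuous_map_from_subtopology continuous_map_product_projection)
    then show ?thesis
      unfolding Q_def using r
      by (auto simp: continuous_map_in_subtopology continuous_map_componentwise)
  qed
  then have "continuous_map (subtopology ?P (beta_embed X ` topspace X)) X (e' \<circ> ?r)"
    using e'(1) by (rule continuous_map_compose)
  then show ?thesis
    unfolding embedding_map_def homeomorphic_map_maps homeomorphic_maps_def
    using e'(2) r continuous_map_beta_embed_product
    by (intro exI [where x = "e' \<circ> ?r"]) (auto simp: continuous_map_in_subtopology)
qed

lemma embedding_map_beta_embed: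
  assumes "Tychonoff_space X"
  shows "embedding_map X (beta X) (beta_embed X)"
  using embedding_map_beta_embed_product [OF assms] beta_embed_subset [of X]
  unfolding topspace_beta
  by (simp add: beta_def Let_def embedding_map_in_subtopology)

lemma ex1_beta_extension:
  fixes h :: "'a \<Rightarrow> 'b"
  assumes h: "continuous_map X Y h" and Y: "compact_space Y" "Hausdorff_space Y"
  shows "\<exists>!F. F \<in> extensional (topspace (beta X)) \<and> continuous_map (beta X) Y F \<and>
              (\<forall>x\<in>topspace X. F (beta_embed X x) = h x)"
proof -
  let ?PX = "product_topology (\<lambda>_. euclideanreal) (C_star X)"
  let ?PY = "product_topology (\<lambda>_. euclideanreal) (C_star Y)"
  have "Tychonoff_space Y"
    using Y by (simp add: Tychonoff_space_def compact_Hausdorff_or_regular_imp_normal_space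
        normal_imp_completely_regular_space)
  from embedding_map_beta_embed_product [OF this]
  obtain j where j: "continuous_map (subtopology ?PY (beta_embed Y ` topspace Y)) Y j"
    "\<And>y. y \<in> topspace Y \<Longrightarrow> j (beta_embed Y y) = y"
    unfolding embedding_map_def homeomorphic_map_maps homeomorphic_maps_def by blast
  have hX: "h x \<in> topspace Y" if "x \<in> topspace X" for x
    using h that by (auto simp: continuous_map_def)
  define c where "c g = restrict (g \<circ> h) (topspace X)" for g :: "'b \<Rightarrow> real"
  have c: "c g \<in> C_star X" if "g \<in> C_star Y" for g
  proof -
    have "continuous_map X euclideanreal (c g)"
      using continuous_map_compose [OF h, of euclideanreal g] that
      by (auto simp: c_def C_star_iff intro: continuous_map_eq)
    moreover have "c g ` topspace X \<subseteq> g ` topspace Y"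
      using hX by (auto simp: c_def)
    ultimately show ?thesis
      using that by (auto simp: C_star_iff c_def intro: bounded_subset)
  qed
  define H where "H p = (\<lambda>g\<in>C_star Y. p (c g))" for p :: "('a \<Rightarrow> real) \<Rightarrow> real"
  have H: "continuous_map ?PX ?PY H"
    using c by (auto simp: H_def continuous_map_componentwise
        intro: continuous_map_product_projection)
  have Hx: "H (beta_embed X x) = beta_embed Y (h x)" if "x \<in> topspace X" for x
    using that c by (auto simp: H_def beta_embed_def c_def fun_eq_iff)
  have "compactin ?PY (beta_embed Y ` topspace Y)"
    using Y(1) unfolding compact_space_def
    by (rule image_compactin [OF _ continuous_map_beta_embed_product])
  then have cl: "closedin ?PY (beta_embed Y ` topspace Y)"
    by (intro compactin_imp_closedin) (auto simp: Hausdorff_space_product_topology)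
  have "H ` (?PX closure_of (beta_embed X ` topspace X))
      \<subseteq> ?PY closure_of (H ` beta_embed X ` topspace X)"
    by (rule continuous_map_image_closure_subset [OF H])
  also have "\<dots> \<subseteq> beta_embed Y ` topspace Y"
    using Hx hX by (intro closure_of_minimal [OF _ cl]) auto
  finally have "continuous_map (beta X) (subtopology ?PY (beta_embed Y ` topspace Y)) H"
    using H by (auto simp: beta_def Let_def continuous_map_in_subtopology
        continuous_map_from_subtopology)
  then have jH: "continuous_map (beta X) Y (j \<circ> H)"
    using j(1) by (rule continuous_map_compose)
  define F where "F = restrict (j \<circ> H) (topspace (beta X))"
  have F: "F \<in> extensional (topspace (beta X)) \<and> continuous_map (beta X) Y F \<and>
      (\<forall>x\<in>topspace X. F (beta_embed X x) = h x)"
    using jH beta_embed_subset [of X] Hx hX j(2)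
    by (auto simp: F_def image_subset_iff intro: continuous_map_eq [OF jH])
  show ?thesis
  proof (rule ex1I [where a = F], rule F)
    fix G assume G: "G \<in> extensional (topspace (beta X)) \<and> continuous_map (beta X) Y G \<and>
      (\<forall>x\<in>topspace X. G (beta_embed X x) = h x)"
    have "G p = F p" if "p \<in> topspace (beta X)" for p
      by (rule forall_in_closure_of_eq [of p "beta X" "beta_embed X ` topspace X" Y])
        (use that F G Y in \<open>auto simp: dense_beta_embed\<close>)
    then show "G = F"
      using F G by (auto intro: extensionalityI)
  qed
qed

lemma ex1_star_extension:
  assumes "f \<in> carrier (C_ring X)"
  shows "\<exists>!F. F \<in> extensional (topspace (beta X)) \<and>
              continuous_map (beta X) (Alexandroff_compactification euclideanreal) F \<and>
              (\<forall>x\<in>topspace X. F (beta_embed X x) = Some (f x))"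
proof -
  have "continuous_map X (Alexandroff_compactification euclideanreal) (Some \<circ> f)"
    using assms by (auto simp: C_ring_def intro: continuous_map_compose continuous_map_Some)
  from ex1_beta_extension [OF this] show ?thesis
    by (simp add: Hausdorff_space_Alexandroff_compactification locally_compact_space_euclidean)
qed

end

theory Submission
  imports Defs
begin

text \<open>A function \<open>f\<close> has \<open>f\<^sup>*(p)\<close> real exactly when \<open>f\<close> is bounded on the trace on \<open>X\<close> of some
  neighbourhood of \<open>p\<close>, and this local condition is visibly inherited by sums and products.
  If \<open>p \<noteq> q\<close>, some \<open>h \<in> C\<^sup>*(X)\<close> separates them, and truncating \<open>\<bar>h - h\<^sup>*(q)\<bar>\<close> from below gives a
  bounded function \<open>k\<close> that vanishes near \<open>q\<close> and is bounded away from \<open>0\<close> near \<open>p\<close>.  Any \<open>f\<close> with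
  \<open>f\<^sup>*(p) = \<infinity>\<close> then gives \<open>f k \<in> C\<^sub>q - C\<^sub>p\<close>.\<close>

lemma star_extension:
  assumes "f \<in> carrier (C_ring X)"
  shows "continuous_map (beta X) (Alexandroff_compactification euclideanreal) (star_extension X f)"
    and "x \<in> topspace X \<Longrightarrow> star_extension X f (beta_embed X x) = Some (f x)"
  using theI' [OF ex1_star_extension [OF assms]] unfolding star_extension_def by blast+

text \<open>The coordinate \<open>h\<close> on \<open>beta X\<close> is the real-valued extension of
  \<open>h\<close>, so \<open>u h\<close> serves below as the value of the extended function at
  \<open>u\<close>.\<close>

lemma continuous_map_beta_projection:
  assumes "h \<in> C_star X"
  shows "continuous_map (beta X) euclideanreal (\<lambda>u. u h)"
  unfolding beta_def Let_def
  using assms by (intro continuous_map_from_subtopology continuous_map_product_projection)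

lemma beta_embed_meets_open:
  assumes "openin (beta X) U" and "p \<in> U"
  obtains x where "x \<in> topspace X" "beta_embed X x \<in> U"
proof -
  have "p \<in> beta X closure_of (beta_embed X ` topspace X)"
    using assms openin_subset unfolding dense_beta_embed by blast
  then show thesis
    using assms that unfolding in_closure_of by blast
qed

text \<open>A finite value gives the bound by pulling back a ball around it. Conversely, if the
  value were \<open>None\<close>, density would put a point of \<open>X\<close> where both
  \<open>\<bar>f x\<bar> \<le> B\<close> and \<open>\<bar>f x\<bar> > B\<close> hold.\<close>

lemma C_at_iff_locally_bounded:
  assumes p: "p \<in> topspace (beta X)"
  shows "f \<in> C_at X p \<longleftrightarrow>
    f \<in> carrier (C_ring X) \<and>
    (\<exists>U B. openin (beta X) U \<and> p \<in> U \<and>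
       (\<forall>x\<in>topspace X. beta_embed X x \<in> U \<longrightarrow> \<bar>f x\<bar> \<le> B))"
    (is "_ \<longleftrightarrow> _ \<and> ?bdd")
proof (cases "f \<in> carrier (C_ring X)")
  case True
  note cont = star_extension(1) [OF True] and ext = star_extension(2) [OF True]
  let ?F = "star_extension X f"
  have "(\<exists>r. ?F p = Some r) \<longleftrightarrow> ?bdd"
  proof
    assume "\<exists>r. ?F p = Some r"
    then obtain r where r: "?F p = Some r" ..
    let ?U = "{u \<in> topspace (beta X). ?F u \<in> Some ` ball r 1}"
    have "openin (beta X) ?U"
      by (rule openin_continuous_map_preimage [OF cont])
        (auto simp: openin_Alexandroff_compactification)
    moreover have "\<bar>f x\<bar> \<le> \<bar>r\<bar> + 1" if "x \<in> topspace X" "beta_embed X x \<in> ?U" for x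
      using that ext by (auto simp: dist_real_def)
    ultimately show ?bdd
      using p r by (intro exI [where x = ?U] exI [where x = "\<bar>r\<bar> + 1"]) auto
  next
    assume ?bdd
    then obtain U B where U: "openin (beta X) U" "p \<in> U"
      and B: "\<And>x. x \<in> topspace X \<Longrightarrow> beta_embed X x \<in> U \<Longrightarrow> \<bar>f x\<bar> \<le> B"
      by blast
    show "\<exists>r. ?F p = Some r"
    proof (rule ccontr)
      assume "\<nexists>r. ?F p = Some r"
      then have None: "?F p = None" by auto
      \<comment> \<open>Closed balls are compact, so this is an open neighbourhood of the point at
        infinity.\<close>
      let ?N = "insert None (Some ` (UNIV - cball 0 B))"
      let ?V = "{u \<in> topspace (beta X). ?F u \<in> ?N}"
      have "openin (beta X) ?V"
        by (rule openin_continuous_map_preimage [OF cont])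
          (auto simp: openin_Alexandroff_compactification intro!: exI [where x = "cball 0 B"])
      then have "openin (beta X) (U \<inter> ?V)" "p \<in> U \<inter> ?V"
        using U p None by auto
      then obtain x where "x \<in> topspace X" "beta_embed X x \<in> U \<inter> ?V"
        by (rule beta_embed_meets_open)
      then show False
        using B [of x] ext [of x] by auto
    qed
  qed
  with True show ?thesis
    by (auto simp: C_at_def)
qed (simp add: C_at_def)

lemma intermediate_ring_C_at:
  assumes p: "p \<in> topspace (beta X)"
  shows "intermediate_ring X (C_at X p)"
proof -
  interpret cring "C_ring X" by (rule cring_C_ring)
  note iff = C_at_iff_locally_bounded [OF p]
  have star: "C_star X \<subseteq> C_at X p"
  proof
    fix f assume f: "f \<in> C_star X"
    then obtain B where "\<forall>x\<in>topspace X. \<bar>f x\<bar> \<le> B"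
      by (auto simp: C_star_def bounded_iff)
    then show "f \<in> C_at X p"
      using f p unfolding iff C_star_def by blast
  qed
  \<comment> \<open>The record \<open>C_ring\<close> does not list negation; its values are
    recovered from the law \<open>r_neg\<close>.\<close>
  have minus: "(\<ominus>\<^bsub>C_ring X\<^esub> f) x = - f x"
    if "f \<in> carrier (C_ring X)" "x \<in> topspace X" for f x
    using fun_cong [OF r_neg [OF that(1)], of x] that(2) by (auto simp: C_ring_def)
  have local: "\<exists>U B C. openin (beta X) U \<and> p \<in> U \<and>
      (\<forall>x\<in>topspace X. beta_embed X x \<in> U \<longrightarrow> \<bar>f x\<bar> \<le> B \<and> \<bar>g x\<bar> \<le> C)"
    if f: "f \<in> C_at X p" and g: "g \<in> C_at X p" for f g
  proof -
    obtain U B where "openin (beta X) U" "p \<in> U"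
      "\<forall>x\<in>topspace X. beta_embed X x \<in> U \<longrightarrow> \<bar>f x\<bar> \<le> B"
      using f unfolding iff by blast
    moreover obtain V C where "openin (beta X) V" "p \<in> V"
      "\<forall>x\<in>topspace X. beta_embed X x \<in> V \<longrightarrow> \<bar>g x\<bar> \<le> C"
      using g unfolding iff by blast
    ultimately show ?thesis
      by (intro exI [where x = "U \<inter> V"] exI [where x = B] exI [where x = C]) auto
  qed
  have "subring (C_at X p) (C_ring X)"
  proof (rule subringI)
    show "C_at X p \<subseteq> carrier (C_ring X)"
      by (auto simp: C_at_def)
    have "\<one>\<^bsub>C_ring X\<^esub> \<in> C_star X"
      using one_closed by (auto simp: C_star_def C_ring_def bounded_iff)
    with star show "\<one>\<^bsub>C_ring X\<^esub> \<in> C_at X p" ..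
  next
    fix f assume f: "f \<in> C_at X p"
    then show "\<ominus>\<^bsub>C_ring X\<^esub> f \<in> C_at X p"
      unfolding iff by (simp add: minus)
  next
    fix f g assume fg: "f \<in> C_at X p" "g \<in> C_at X p"
    then have car: "f \<in> carrier (C_ring X)" "g \<in> carrier (C_ring X)"
      by (auto simp: C_at_def)
    obtain U B C where U: "openin (beta X) U" "p \<in> U"
      and BC: "\<And>x. x \<in> topspace X \<Longrightarrow> beta_embed X x \<in> U \<Longrightarrow> \<bar>f x\<bar> \<le> B \<and> \<bar>g x\<bar> \<le> C"
      using local [OF fg] by blast
    have "\<bar>(f \<otimes>\<^bsub>C_ring X\<^esub> g) x\<bar> \<le> B * C"
      if "x \<in> topspace X" "beta_embed X x \<in> U" for x
    proof -
      \<comment> \<open>\<open>mult_mono\<close> requires \<open>B\<close> to be nonnegative, which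
        the point \<open>x\<close> itself supplies through
        \<open>\<bar>f x\<bar> \<le> B\<close>.\<close>
      have "\<bar>f x\<bar> * \<bar>g x\<bar> \<le> B * C"
        using BC [OF that] by (intro mult_mono) auto
      then show ?thesis
        using that by (simp add: C_ring_def abs_mult)
    qed
    then show "f \<otimes>\<^bsub>C_ring X\<^esub> g \<in> C_at X p"
      using car U unfolding iff by blast
    have "\<bar>(f \<oplus>\<^bsub>C_ring X\<^esub> g) x\<bar> \<le> B + C"
      if "x \<in> topspace X" "beta_embed X x \<in> U" for x
      using BC [OF that] that abs_triangle_ineq [of "f x" "g x"] by (simp add: C_ring_def)
    then show "f \<oplus>\<^bsub>C_ring X\<^esub> g \<in> C_at X p"
      using car U unfolding iff by blast
  qed
  with star show ?thesis
    by (simp add: intermediate_ring_def)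
qed

lemma C_at_not_subset:
  assumes p: "p \<in> topspace (beta X) - upsilon X" and q: "q \<in> topspace (beta X)" and "p \<noteq> q"
  shows "\<not> C_at X q \<subseteq> C_at X p"
proof -
  \<comment> \<open>Points of \<open>beta X\<close> are extensional families indexed by
    \<open>C_star X\<close>, so distinct points differ at some coordinate \<open>h\<close>.\<close>
  have "p \<in> extensional (C_star X)" "q \<in> extensional (C_star X)"
    using p q closure_of_subset_topspace by (fastforce simp: topspace_beta PiE_iff)+
  then obtain h where h: "h \<in> C_star X" "p h \<noteq> q h"
    using \<open>p \<noteq> q\<close> by (meson extensionalityI)
  obtain f where f: "f \<in> carrier (C_ring X)" "f \<notin> C_at X p"
    using p by (auto simp: upsilon_def C_at_def)
  \<comment> \<open>With the values at \<open>p\<close> and \<open>q\<close> exactly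
    \<open>4 * d\<close> apart, \<open>k\<close> vanishes where \<open>h\<close> is within
    \<open>2 * d\<close> of \<open>q h\<close>, and exceeds \<open>d\<close> where \<open>h\<close>
    is within \<open>d\<close> of \<open>p h\<close>.\<close>
  define d where "d = \<bar>p h - q h\<bar> / 4"
  have d: "d > 0" using h by (simp add: d_def)
  define k where "k x = max 0 (\<bar>h x - q h\<bar> - 2 * d)" for x
  define g where "g = (\<lambda>x\<in>topspace X. f x * k x)"
  have "continuous_map X euclideanreal k"
    using h unfolding k_def C_star_iff
    by (intro continuous_intros continuous_map_real_max continuous_map_real_abs) auto
  then have g: "g \<in> carrier (C_ring X)"
    using f by (auto simp: g_def C_ring_def
        intro: continuous_map_eq [where f = "\<lambda>x. f x * k x"] continuous_map_real_mult)
  have nbhd: "openin (beta X) {u \<in> topspace (beta X). u h \<in> ball c d}" for c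
    by (rule openin_continuous_map_preimage [OF continuous_map_beta_projection [OF h(1)]]) simp
  have h_eq: "beta_embed X x h = h x" for x
    using h by (simp add: beta_embed_def)
  \<comment> \<open>The bound 0 works, because \<open>k\<close> and hence \<open>g\<close> vanish
    near \<open>q\<close>.\<close>
  have "g \<in> C_at X q"
    unfolding C_at_iff_locally_bounded [OF q]
    using g q d nbhd [of "q h"]
    by (intro conjI exI [where x = "{u \<in> topspace (beta X). u h \<in> ball (q h) d}"] exI [where x = 0])
      (auto simp: h_eq g_def k_def dist_real_def)
  moreover have "g \<notin> C_at X p"
  proof
    assume "g \<in> C_at X p"
    then obtain U B where U: "openin (beta X) U" "p \<in> U"
      and B: "\<And>x. x \<in> topspace X \<Longrightarrow> beta_embed X x \<in> U \<Longrightarrow> \<bar>g x\<bar> \<le> B"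
      using p C_at_iff_locally_bounded [of p X g] by blast
    let ?V = "U \<inter> {u \<in> topspace (beta X). u h \<in> ball (p h) d}"
    \<comment> \<open>Near \<open>p\<close> the factor \<open>k\<close> is at least
      \<open>d\<close>, so dividing by it turns a bound on \<open>g\<close> into one on
      \<open>f\<close>, against the choice of \<open>f\<close>.\<close>
    have "\<bar>f x\<bar> \<le> B / d" if x: "x \<in> topspace X" "beta_embed X x \<in> ?V" for x
    proof -
      have "d \<le> k x"
      proof -
        have "\<bar>p h - h x\<bar> < d"
          using x(2) by (simp add: h_eq dist_real_def)
        moreover have "\<bar>p h - q h\<bar> = 4 * d"
          by (simp add: d_def)
        ultimately show ?thesis
          unfolding k_def by linarith
      qed
      then have "\<bar>f x\<bar> * d \<le> \<bar>f x\<bar> * \<bar>k x\<bar>"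
        by (intro mult_left_mono) auto
      also have "\<dots> \<le> B"
        using B [of x] x by (simp add: g_def abs_mult)
      finally show ?thesis
        using d by (simp add: field_simps)
    qed
    moreover have "openin (beta X) ?V" "p \<in> ?V"
      using U nbhd p d by auto
    ultimately have "f \<in> C_at X p"
      using f(1) p C_at_iff_locally_bounded [of p X f] by blast
    with f(2) show False ..
  qed
  ultimately show ?thesis by blast
qed

theorem corollary2p5:
  fixes X :: "'a topology" and p q :: "('a \<Rightarrow> real) \<Rightarrow> real"
  assumes "Tychonoff_space X"
    and "p \<in> topspace (beta X) - upsilon X"
    and "q \<in> topspace (beta X) - upsilon X"
    and "p \<noteq> q"
  shows "intermediate_ring X (C_at X p) \<and> intermediate_ring X (C_at X q) \<and> C_at X p \<noteq> C_at X q"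
  using assms intermediate_ring_C_at C_at_not_subset [of p X q] by blast

end
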